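(* Let $n\ge1$. The distribution of the number of weak descents on $\mathcal{C}_n$ is symmetric, in the sense that $$|\{\pi\in\mathcal{C}_n:\mathrm{wdes}(\pi)=r\}|=|\{\pi\in\mathcal{C}_n:\mathrm{wdes}(\pi)=2n-r\}|$$ for all integers $r$.
   Context: Let $[n]=\{1,\dots,n\}$ and let $[n]\sqcup[n]=\{1,1,2,2,\dots,n,n\}$ be the multiset with two copies of each element of $[n]$. A permutation $\pi=\pi_1\pi_2\dots\pi_{2n}$ of $[n]\sqcup[n]$ is nonnesting if there do not exist $i<j<\ell<m$ with $\pi_i=\pi_m$ and $\pi_j=\pi_\ell$; $\mathcal{C}_n$ denotes the set of nonnesting permutations of $[n]\sqcup[n]$. For $\pi\in\mathcal{C}_n$, $\mathrm{wdes}(\pi)=|\{i\in[2n-1]:\pi_i\ge\pi_{i+1}\}|$ is its number of weak descents. *)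

theory Defs
  imports "HOL-Combinatorics.Multiset_Permutations"
begin

(* Words are lists, so positions are counted from 0 instead of 1. *)

definition nonnesting :: "'a list \<Rightarrow> bool" where
  "nonnesting p \<longleftrightarrow>
     \<not> (\<exists>i j l m. i < j \<and> j < l \<and> l < m \<and> m < length p \<and> p ! i = p ! m \<and> p ! j = p ! l)"

definition nonnesting_perms :: "nat \<Rightarrow> nat list set" where
  "nonnesting_perms n =
     {p \<in> permutations_of_multiset (mset_set {1..n} + mset_set {1..n}). nonnesting p}"

definition wdes :: "nat list \<Rightarrow> nat" where
  "wdes p = card {i. Suc i < length p \<and> p ! i \<ge> p ! Suc i}"

end

theory Submission
  imports Defs "HOL-Library.Product_Lexorder" "HOL-Library.Sublist"
begin

text \<open>
  Attach to the letters of a nonnesting permutation weakly increasing levels below \<open>m\<close>, with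
  a strict increase at every descent (respectively, at every weak descent). With \<open>des\<close> the number
  of strict descents, the number of ways depends only on \<open>m - des p\<close> (respectively,
  \<open>m - wdes p\<close>), so the sums of these numbers over all permutations, for all \<open>m\<close>, determine
  the distribution of \<open>des\<close> (respectively, \<open>wdes\<close>).
  A levelled permutation is recovered by sorting from the pairs of levels \<open>f v \<le> g v\<close>
  (respectively, \<open>f v < g v\<close>) of the two copies of each value \<open>v\<close>, and being nonnesting means
  that \<open>(f v, v)\<close> and \<open>(g v, v)\<close> induce the same lexicographic order on the values. Replacing
  \<open>g\<close> by \<open>g + 1\<close> preserves this condition and turns the weak inequalities below \<open>m\<close> into
  the strict ones below \<open>m + 1\<close>. Hence \<open>wdes\<close> is distributed as \<open>des + 1\<close>, and reversal takes
  \<open>des + 1\<close> to \<open>2 * n - wdes\<close>.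
\<close>

section \<open>Recovering distributions from sums, and counting level sequences\<close>

definition des :: "nat list \<Rightarrow> nat" where
  "des p = card {i. Suc i < length p \<and> p ! i > p ! Suc i}"

text \<open>The sums form a triangular system in the sizes of the level sets. For
  \<open>m = Suc k\<close>, elements whose statistic exceeds \<open>k\<close> contribute
  \<open>g 0 = 0\<close>, the level sets below \<open>k\<close> agree by induction, and the one at
  \<open>k\<close> has the positive coefficient \<open>g 1\<close>, which cancels.\<close>

lemma card_level_sets_eq_from_sums:
  fixes u v :: "'a \<Rightarrow> nat" and g :: "nat \<Rightarrow> nat"
  assumes fin: "finite A" and g0: "g 0 = 0" and g1: "g 1 > 0"
    and eq: "\<And>m. (\<Sum>x\<in>A. g (m - u x)) = (\<Sum>x\<in>A. g (m - v x))"
  shows "card {x \<in> A. u x = k} = card {x \<in> A. v x = k}"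
proof (induction k rule: less_induct)
  case (less k)
  have split: "(\<Sum>x\<in>A. g (Suc k - w x))
      = (\<Sum>j<k. card {x \<in> A. w x = j} * g (Suc k - j)) + card {x \<in> A. w x = k} * g 1"
    for w :: "'a \<Rightarrow> nat"
  proof -
    have "(\<Sum>x\<in>A. g (Suc k - w x)) = (\<Sum>x\<in>{x\<in>A. w x \<le> k}. g (Suc k - w x))"
      by (rule sum.mono_neutral_right) (use fin g0 in \<open>auto simp: not_le Suc_leI\<close>)
    also have "\<dots> = (\<Sum>j\<le>k. \<Sum>x\<in>{x\<in>{x\<in>A. w x \<le> k}. w x = j}. g (Suc k - w x))"
      by (rule sum.group[symmetric]) (use fin in auto)
    also have "\<dots> = (\<Sum>j\<le>k. card {x \<in> A. w x = j} * g (Suc k - j))"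
    proof (rule sum.cong)
      fix j assume "j \<in> {..k}"
      then have "{x\<in>{x\<in>A. w x \<le> k}. w x = j} = {x \<in> A. w x = j}" by auto
      then show "(\<Sum>x\<in>{x\<in>{x\<in>A. w x \<le> k}. w x = j}. g (Suc k - w x))
        = card {x \<in> A. w x = j} * g (Suc k - j)" by simp
    qed simp
    also have "{..k} = insert k {..<k}" by auto
    finally show ?thesis by (simp add: Suc_diff_le)
  qed
  have "(\<Sum>j<k. card {x \<in> A. u x = j} * g (Suc k - j))
      = (\<Sum>j<k. card {x \<in> A. v x = j} * g (Suc k - j))"
    by (rule sum.cong) (use less.IH in auto)
  then show ?case using eq[of "Suc k"] split[of u] split[of v] g1 by simp
qed

text \<open>Subtracting from each entry the number of forced strict steps before it leaves a weakly
  increasing sequence, and lowers the bound by the total number of forced steps. If \<open>m\<close>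
  is at most that number, both sets are empty because \<open>L > 0\<close>.\<close>

lemma card_strict_steps:
  fixes D :: "nat set" and L m :: nat
  assumes L: "L > 0"
  shows "card {h. length h = L \<and> set h \<subseteq> {..<m} \<and>
              (\<forall>i. Suc i < L \<longrightarrow> h ! i + of_bool (i \<in> D) \<le> h ! Suc i)}
       = card {h. length h = L \<and> set h \<subseteq> {..<m - card {i \<in> D. Suc i < L}} \<and> sorted h}"
    (is "card ?X = card ?Y")
proof -
  define c where "c i = card (D \<inter> {..<i})" for i
  define up where "up h = map (\<lambda>i. h ! i + c i) [0..<L]" for h
  define dn where "dn h = map (\<lambda>i. h ! i - c i) [0..<L]" for h
  have c0: "c 0 = 0" by (simp add: c_def)
  have cS: "c (Suc i) = c i + of_bool (i \<in> D)" for i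
    by (simp add: c_def lessThan_Suc Int_insert_right)
  have cL: "card {i \<in> D. Suc i < L} = c (L - 1)"
    unfolding c_def by (rule arg_cong[where f=card]) auto
  have c_le: "c i \<le> c (L - 1)" if "i < L" for i
    unfolding c_def by (rule card_mono) (use that in auto)
  have set_iff: "set h \<subseteq> {..<M} \<longleftrightarrow> (\<forall>i<L. h ! i < M)" if "length h = L" for h :: "nat list" and M
    using that by (auto simp: set_conv_nth)
  \<comment> \<open>Subtraction is truncated, so this bound is what makes \<open>up\<close> undo
    \<open>dn\<close>.\<close>
  have lower: "c i \<le> h ! i" if "h \<in> ?X" "i < L" for h i
    using that(2)
  proof (induction i)
    case (Suc i)
    then have "h ! i + of_bool (i \<in> D) \<le> h ! Suc i" using that(1) by auto
    then show ?case using Suc cS[of i] by simp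
  qed (simp add: c0)
  have bij: "bij_betw dn ?X ?Y"
  proof (rule bij_betw_byWitness[where f' = up])
    show "\<forall>h\<in>?X. up (dn h) = h"
    proof
      fix h assume h: "h \<in> ?X"
      show "up (dn h) = h"
        by (rule nth_equalityI) (use h lower[OF h] in \<open>simp_all add: up_def dn_def\<close>)
    qed
    show "\<forall>h\<in>?Y. dn (up h) = h"
      by (auto simp: up_def dn_def intro!: nth_equalityI)
    show "dn ` ?X \<subseteq> ?Y"
    proof (rule image_subsetI)
      fix h assume h: "h \<in> ?X"
      have len: "length (dn h) = L" by (simp add: dn_def)
      have st: "sorted (dn h)"
        unfolding sorted_iff_nth_Suc
      proof (intro allI impI)
        fix i assume "Suc i < length (dn h)"
        then have i: "Suc i < L" using len by simp
        then have "h ! i + of_bool (i \<in> D) \<le> h ! Suc i" using h by auto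
        then show "dn h ! i \<le> dn h ! Suc i"
          using i cS[of i] by (simp add: dn_def)
      qed
      \<comment> \<open>The last entry is the largest one, so bounding it suffices; all forced steps
        lie before it.\<close>
      have "dn h ! i < m - c (L - 1)" if "i < L" for i
      proof -
        have "dn h ! i \<le> dn h ! (L - 1)"
          using st that len by (intro sorted_nth_mono) auto
        also have "\<dots> = h ! (L - 1) - c (L - 1)" using L by (simp add: dn_def)
        also have "\<dots> < m - c (L - 1)"
        proof (rule diff_less_mono)
          show "h ! (L - 1) < m" using h L set_iff[of h m] by simp
          show "c (L - 1) \<le> h ! (L - 1)" using lower[OF h] L by simp
        qed
        finally show ?thesis .
      qed
      then have "set (dn h) \<subseteq> {..<m - c (L - 1)}" using set_iff[OF len] by blast
      then show "dn h \<in> ?Y" using st len cL by simp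
    qed
    show "up ` ?Y \<subseteq> ?X"
    proof (rule image_subsetI)
      fix h assume h: "h \<in> ?Y"
      have len: "length (up h) = L" by (simp add: up_def)
      have "up h ! i < m" if "i < L" for i
      proof -
        have "h ! i < m - c (L - 1)" using h that cL by (auto simp: set_conv_nth)
        then show ?thesis using c_le[OF that] that by (simp add: up_def)
      qed
      moreover have "up h ! i + of_bool (i \<in> D) \<le> up h ! Suc i" if "Suc i < L" for i
      proof -
        have "h ! i \<le> h ! Suc i" using h that by (auto simp: sorted_iff_nth_Suc)
        then show ?thesis using that cS[of i] by (simp add: up_def)
      qed
      ultimately show "up h \<in> ?X" using set_iff[OF len] len by simp
    qed
  qed
  then show ?thesis by (rule bij_betw_same_card)
qed

text \<open>In the lexicographic order on (level, letter), the level has to grow strictly exactly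
  where the letter drops, so the forced steps are the strict descents of \<open>p\<close>.\<close>

lemma card_sorted_zip:
  fixes p :: "nat list"
  assumes "p \<noteq> []"
  shows "card {h :: nat list. length h = length p \<and> set h \<subseteq> {..<m} \<and> sorted (zip h p)}
       = card {h. length h = length p \<and> set h \<subseteq> {..<m - des p} \<and> sorted h}"
proof -
  have 1: "sorted (zip h p) \<longleftrightarrow>
      (\<forall>i. Suc i < length p \<longrightarrow> h ! i + of_bool (i \<in> {i. p ! i > p ! Suc i}) \<le> h ! Suc i)"
    if "length h = length p" for h :: "nat list"
  proof -
    have "(h ! i, p ! i) \<le> (h ! Suc i, p ! Suc i) \<longleftrightarrow>
        h ! i + of_bool (i \<in> {i. p ! i > p ! Suc i}) \<le> h ! Suc i" for i
      by (cases "p ! i > p ! Suc i") auto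
    then show ?thesis using that by (simp add: sorted_iff_nth_Suc)
  qed
  show ?thesis
    using card_strict_steps[of "length p" m "{i. p ! i > p ! Suc i}"] assms 1
    by (simp add: des_def conj_commute cong: conj_cong)
qed

text \<open>Distinctness makes the order of the pairs strict, so equal adjacent letters force a step
  as well and weak descents take over the role of strict ones.\<close>

lemma card_strict_sorted_zip:
  fixes p :: "nat list"
  assumes "p \<noteq> []"
  shows "card {h :: nat list. length h = length p \<and> set h \<subseteq> {..<m} \<and>
            sorted (zip h p) \<and> distinct (zip h p)}
       = card {h. length h = length p \<and> set h \<subseteq> {..<m - wdes p} \<and> sorted h}"
proof -
  have 1: "sorted (zip h p) \<and> distinct (zip h p) \<longleftrightarrow>
      (\<forall>i. Suc i < length p \<longrightarrow> h ! i + of_bool (i \<in> {i. p ! i \<ge> p ! Suc i}) \<le> h ! Suc i)"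
    if "length h = length p" for h :: "nat list"
  proof -
    have "(h ! i, p ! i) < (h ! Suc i, p ! Suc i) \<longleftrightarrow>
        h ! i + of_bool (i \<in> {i. p ! i \<ge> p ! Suc i}) \<le> h ! Suc i" for i
      by (cases "p ! i \<ge> p ! Suc i") auto
    moreover have "sorted (zip h p) \<and> distinct (zip h p) \<longleftrightarrow> sorted_wrt (<) (zip h p)"
      by (rule strict_sorted_iff[symmetric])
    ultimately show ?thesis using that
      by (simp only: sorted_wrt_iff_nth_Suc_transp[OF transp_on_less]) simp
  qed
  show ?thesis
    using card_strict_steps[of "length p" m "{i. p ! i \<ge> p ! Suc i}"] assms 1
    by (simp add: wdes_def conj_commute cong: conj_cong)
qed

section \<open>Nonnesting in terms of the levels of the two copies\<close>

lemma subseq_Cons_iff_nth: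
  "subseq (x # xs) ys \<longleftrightarrow> (\<exists>i < length ys. ys ! i = x \<and> subseq xs (drop (Suc i) ys))"
proof (induction ys)
  case (Cons y ys)
  have "subseq (x # xs) (y # ys) \<longleftrightarrow> (y = x \<and> subseq xs ys) \<or> subseq (x # xs) ys"
    using subseq_Cons2_iff[of x xs y ys] subseq_Cons'[of x xs ys] by auto
  then show ?case
    unfolding Cons.IH by (simp add: Ex_less_Suc2)
qed simp

lemma subseq_Cons_drop_iff:
  "subseq (x # xs) (drop q ys) \<longleftrightarrow>
    (\<exists>k. q \<le> k \<and> k < length ys \<and> ys ! k = x \<and> subseq xs (drop (Suc k) ys))"
  (is "?L \<longleftrightarrow> ?R")
proof
  assume ?L
  then obtain i where "i < length ys - q" "drop q ys ! i = x" "subseq xs (drop (Suc i) (drop q ys))"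
    unfolding subseq_Cons_iff_nth by auto
  then show ?R by (intro exI[of _ "q + i"]) (auto simp: add_ac)
next
  assume ?R
  then obtain k where "q \<le> k" "k < length ys" "ys ! k = x" "subseq xs (drop (Suc k) ys)"
    by blast
  then show ?L
    unfolding subseq_Cons_iff_nth by (intro exI[of _ "k - q"]) auto
qed

text \<open>As a subsequence, the forbidden pattern can be moved along \<open>filter\<close>,
  \<open>map\<close> and \<open>nths\<close> without handling indices.\<close>

lemma nonnesting_iff_subseq: "nonnesting p \<longleftrightarrow> \<not> (\<exists>a b. subseq [a, b, b, a] p)"
proof -
  have "subseq [a, b, b, a] p \<longleftrightarrow>
      (\<exists>i j l m. i < j \<and> j < l \<and> l < m \<and> m < length p \<and>
        p ! i = a \<and> p ! j = b \<and> p ! l = b \<and> p ! m = a)" (is "?L \<longleftrightarrow> ?R") for a b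
  proof -
    have "?L \<longleftrightarrow> (\<exists>i < length p. p ! i = a \<and> (\<exists>j. i < j \<and> j < length p \<and> p ! j = b \<and>
        (\<exists>l. j < l \<and> l < length p \<and> p ! l = b \<and> (\<exists>m. l < m \<and> m < length p \<and> p ! m = a))))"
      by (simp add: subseq_Cons_iff_nth[of a "[b, b, a]"] subseq_Cons_drop_iff Suc_le_eq)
    also have "\<dots> \<longleftrightarrow> ?R"
    proof
      assume ?R
      then obtain i j l m where *: "i < j" "j < l" "l < m" "m < length p"
        "p ! i = a" "p ! j = b" "p ! l = b" "p ! m = a" by blast
      then have "i < length p" "j < length p" "l < length p" by linarith+
      with * show "\<exists>i < length p. p ! i = a \<and> (\<exists>j. i < j \<and> j < length p \<and> p ! j = b \<and>
        (\<exists>l. j < l \<and> l < length p \<and> p ! l = b \<and> (\<exists>m. l < m \<and> m < length p \<and> p ! m = a)))"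
        by blast
    qed blast
    finally show ?thesis .
  qed
  then show ?thesis unfolding nonnesting_def by metis
qed

text \<open>The level is the first component, so that it comes first in the lexicographic order. A
  multiset is used because the two copies of \<open>v\<close> coincide when
  \<open>f v = g v\<close>.\<close>

definition copies :: "'a set \<Rightarrow> ('a \<Rightarrow> nat) \<Rightarrow> ('a \<Rightarrow> nat) \<Rightarrow> (nat \<times> 'a) multiset" where
  "copies A f g = image_mset (\<lambda>v. (f v, v)) (mset_set A) + image_mset (\<lambda>v. (g v, v)) (mset_set A)"

lemma count_copies:
  assumes "finite A"
  shows "count (copies A f g) (h, v) = of_bool (v \<in> A \<and> f v = h) + of_bool (v \<in> A \<and> g v = h)"
proof -
  have "inj_on (\<lambda>v. (k v, v)) A" for k :: "'a \<Rightarrow> nat" by (auto simp: inj_on_def)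
  then show ?thesis
    using assms by (auto simp: copies_def image_mset_mset_set count_mset_set' image_iff)
qed

lemma filter_copies:
  assumes "finite A" "v \<in> A"
  shows "filter_mset (\<lambda>z. snd z = v) (copies A f g) = {#(f v, v), (g v, v)#}"
  by (rule multiset_eqI) (use assms in \<open>auto simp: count_copies\<close>)

lemma subseq_imp_mset_subset: "subseq xs ys \<Longrightarrow> mset xs \<subseteq># mset ys"
  by (induction rule: list_emb.induct) (auto intro: subset_mset.order_trans)

lemma distinct_iff_count_le_1: "distinct xs \<longleftrightarrow> (\<forall>x. count (mset xs) x \<le> 1)"
  unfolding distinct_count_atmost_1
  by (auto simp: le_Suc_eq count_eq_zero_iff count_mset_0_iff)

lemma size_filter_snd_eq: "size (filter_mset (\<lambda>z. snd z = v) M) = count (image_mset snd M) v"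
  by (induction M) auto

lemma mset_subset_eq_size_eq: "M \<subseteq># N \<Longrightarrow> size M = size N \<Longrightarrow> M = N"
  using mset_subset_size[of M N] unfolding subset_mset.le_less by auto

lemma doubleton_mset_eq_ordered:
  fixes x y :: "'a::order"
  assumes "{#x, y#} = {#x', y'#}" "x \<le> y" "x' \<le> y'"
  shows "x = x' \<and> y = y'"
  using assms by (auto simp: add_eq_conv_ex)

text \<open>In sorted order the first copy of \<open>v\<close> has level \<open>f v\<close> and the
  second has level \<open>g v\<close>. Thus \<open>b\<close> is nested inside \<open>a\<close>
  exactly when the first copies are ordered with \<open>a\<close> before \<open>b\<close> and the
  second copies with \<open>b\<close> before \<open>a\<close>.\<close>

lemma nonnesting_copies_iff:
  fixes f g :: "'a::linorder \<Rightarrow> nat"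
  assumes fin: "finite A" and le: "\<And>v. v \<in> A \<Longrightarrow> f v \<le> g v"
    and zs: "sorted zs" "mset zs = copies A f g"
  shows "nonnesting (map snd zs) \<longleftrightarrow>
    (\<forall>a\<in>A. \<forall>b\<in>A. \<not> ((f a, a) < (f b, b) \<and> (g b, b) < (g a, a)))"
proof -
  have "\<exists>a b. subseq [a, b, b, a] (map snd zs)"
    if ab: "a \<in> A" "b \<in> A" "(f a, a) < (f b, b)" "(g b, b) < (g a, a)" for a b
  proof -
    let ?ws = "[(f a, a), (f b, b), (g b, b), (g a, a)]"
    let ?fs = "filter (\<lambda>z. snd z \<in> {a, b}) zs"
    have "a \<noteq> b" using ab by auto
    \<comment> \<open>Both lists are sorted, so equality as multisets gives equality as
      lists.\<close>
    have "mset ?fs = mset ?ws"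
    proof (rule multiset_eqI)
      fix z :: "nat \<times> 'a"
      show "count (mset ?fs) z = count (mset ?ws) z"
        using \<open>a \<noteq> b\<close> ab(1,2) by (cases z) (auto simp: zs(2) count_copies[OF fin])
    qed
    moreover have "sorted ?ws" using ab le[of b] by auto
    moreover have "sorted ?fs" using zs(1) by (simp add: sorted_wrt_filter)
    ultimately have "?fs = ?ws" by (metis properties_for_sort)
    then have "subseq (map snd ?ws) (map snd zs)"
      by (metis subseq_filter_left subseq_map)
    then show ?thesis by auto
  qed
  moreover have "\<exists>a\<in>A. \<exists>b\<in>A. (f a, a) < (f b, b) \<and> (g b, b) < (g a, a)"
    if sub: "subseq [a, b, b, a] (map snd zs)" for a b
  proof -
    \<comment> \<open>The positions of the pattern among the letters also select the corresponding
      pairs in \<open>zs\<close>.\<close>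
    obtain N where N: "[a, b, b, a] = nths (map snd zs) N"
      using sub subseq_conv_nths by blast
    define ws where "ws = nths zs N"
    have "map snd ws = [a, b, b, a]" by (simp add: ws_def N nths_map)
    then obtain x1 y1 y2 x2 where ws: "ws = [(x1, a), (y1, b), (y2, b), (x2, a)]"
      by (auto simp: map_eq_Cons_conv)
    have "sorted ws" using zs(1) unfolding ws_def by (rule sorted_nths)
    have sub: "mset ws \<subseteq># copies A f g"
      unfolding ws_def zs(2)[symmetric]
      by (rule subseq_imp_mset_subset) (auto simp: subseq_conv_nths)
    then have fsub: "filter_mset P (mset ws) \<subseteq># filter_mset P (copies A f g)" for P
      by (rule multiset_filter_mono)
    have "(x1, a) \<in># copies A f g" "(y1, b) \<in># copies A f g"
      using mset_subset_eqD[OF sub] ws by simp_all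
    then have "a \<in> A" "b \<in> A" using fin by (auto simp: copies_def)
    have fa: "filter_mset (\<lambda>z. snd z = a) (mset ws) \<subseteq># {#(f a, a), (g a, a)#}"
      using fsub filter_copies[OF fin \<open>a \<in> A\<close>] by metis
    have fb: "filter_mset (\<lambda>z. snd z = b) (mset ws) \<subseteq># {#(f b, b), (g b, b)#}"
      using fsub filter_copies[OF fin \<open>b \<in> A\<close>] by metis
    \<comment> \<open>For \<open>a = b\<close> the pattern would contain four copies of a value that
      has only two.\<close>
    have "a \<noteq> b" using size_mset_mono[OF fa] ws by auto
    \<comment> \<open>An inclusion of two-element multisets is an equality, and sortedness then
      tells which copy is which.\<close>
    have "{#(x1, a), (x2, a)#} = {#(f a, a), (g a, a)#}"
      using fa \<open>a \<noteq> b\<close> ws by (intro mset_subset_eq_size_eq) simp_all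
    then have "x1 = f a" "x2 = g a"
      using doubleton_mset_eq_ordered[of "(x1, a)" "(x2, a)" "(f a, a)" "(g a, a)"]
        le[OF \<open>a \<in> A\<close>] \<open>sorted ws\<close> ws by auto
    have "{#(y1, b), (y2, b)#} = {#(f b, b), (g b, b)#}"
      using fb \<open>a \<noteq> b\<close> ws by (intro mset_subset_eq_size_eq) simp_all
    then have "y1 = f b" "y2 = g b"
      using doubleton_mset_eq_ordered[of "(y1, b)" "(y2, b)" "(f b, b)" "(g b, b)"]
        le[OF \<open>b \<in> A\<close>] \<open>sorted ws\<close> ws by auto
    have "(f a, a) \<le> (f b, b)" "(g b, b) \<le> (g a, a)"
      using \<open>sorted ws\<close> unfolding ws \<open>x1 = f a\<close> \<open>x2 = g a\<close> \<open>y1 = f b\<close> \<open>y2 = g b\<close>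
      by simp_all
    moreover have "(f a, a) \<noteq> (f b, b)" "(g b, b) \<noteq> (g a, a)" using \<open>a \<noteq> b\<close> by auto
    ultimately show ?thesis using \<open>a \<in> A\<close> \<open>b \<in> A\<close> le_neq_trans by blast
  qed
  ultimately show ?thesis unfolding nonnesting_iff_subseq by blast
qed

section \<open>Levelled words, pairs of levels, and the shift\<close>

definition level_pairs :: "'a::linorder set \<Rightarrow> nat \<Rightarrow> (('a \<Rightarrow> nat) \<times> ('a \<Rightarrow> nat)) set" where
  "level_pairs A m = {(f, g). f \<in> A \<rightarrow>\<^sub>E {..<m} \<and> g \<in> A \<rightarrow>\<^sub>E {..<m} \<and> (\<forall>v\<in>A. f v \<le> g v) \<and>
     (\<forall>a\<in>A. \<forall>b\<in>A. \<not> ((f a, a) < (f b, b) \<and> (g b, b) < (g a, a)))}"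

text \<open>Permutation and levels are kept in one list, whose sortedness encodes the weak increase
  of levels and their strict increase at descents.\<close>

definition levelled_words :: "'a::linorder set \<Rightarrow> nat \<Rightarrow> (nat \<times> 'a) list set" where
  "levelled_words A m = {zs. sorted zs \<and> fst ` set zs \<subseteq> {..<m} \<and>
     mset (map snd zs) = mset_set A + mset_set A \<and> nonnesting (map snd zs)}"

text \<open>Sorting is inverted by reading off the lower and the higher level of each value. Since
  \<open>f v \<le> g v\<close>, the unordered pair of levels of \<open>v\<close> determines
  \<open>f v\<close> and \<open>g v\<close>.\<close>

lemma bij_betw_level_pairs:
  fixes A :: "'a::linorder set"
  assumes fin: "finite A"
  shows "bij_betw (\<lambda>(f, g). sorted_list_of_multiset (copies A f g)) (level_pairs A m) (levelled_words A m)"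
    (is "bij_betw ?F _ _")
proof (rule bij_betw_imageI)
  show "inj_on ?F (level_pairs A m)"
  proof (rule inj_onI, clarify)
    fix f g f' g'
    assume fg: "(f, g) \<in> level_pairs A m" and fg': "(f', g') \<in> level_pairs A m"
      and "sorted_list_of_multiset (copies A f g) = sorted_list_of_multiset (copies A f' g')"
    then have eq: "copies A f g = copies A f' g'"
      by (metis mset_sorted_list_of_multiset)
    have "f v = f' v \<and> g v = g' v" if v: "v \<in> A" for v
    proof -
      have "{#(f v, v), (g v, v)#} = {#(f' v, v), (g' v, v)#}"
        using filter_copies[OF fin v] eq by metis
      then show ?thesis
        using doubleton_mset_eq_ordered[of "(f v, v)" "(g v, v)" "(f' v, v)" "(g' v, v)"]
          fg fg' v by (auto simp: level_pairs_def)
    qed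
    then show "f = f' \<and> g = g'"
      using fg fg' by (auto simp: level_pairs_def intro: PiE_ext)
  qed
next
  show "?F ` level_pairs A m = levelled_words A m"
  proof (intro equalityI subsetI)
    fix zs assume "zs \<in> ?F ` level_pairs A m"
    then obtain f g where fg: "(f, g) \<in> level_pairs A m"
      and zs: "zs = sorted_list_of_multiset (copies A f g)" by auto
    have mz: "mset zs = copies A f g" and sz: "sorted zs" by (simp_all add: zs)
    have "nonnesting (map snd zs)"
      using nonnesting_copies_iff[OF fin _ sz mz] fg by (auto simp: level_pairs_def)
    moreover have "mset (map snd zs) = mset_set A + mset_set A"
      by (simp add: mz copies_def multiset.map_comp comp_def)
    moreover have "fst ` set zs \<subseteq> {..<m}"
      using fg fin unfolding set_mset_mset[symmetric] mz
      by (auto simp: copies_def level_pairs_def)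
    ultimately show "zs \<in> levelled_words A m" using sz by (simp add: levelled_words_def)
  next
    fix zs assume "zs \<in> levelled_words A m"
    then have sz: "sorted zs" and bd: "fst ` set zs \<subseteq> {..<m}"
      and ms: "image_mset snd (mset zs) = mset_set A + mset_set A" and nn: "nonnesting (map snd zs)"
      by (auto simp: levelled_words_def)
    \<comment> \<open>Each value occurs exactly twice in the word, so its levels form a pair, which
      can be put in increasing order.\<close>
    have "\<exists>x y. x \<le> y \<and> filter_mset (\<lambda>z. snd z = v) (mset zs) = {#(x, v), (y, v)#}"
      if v: "v \<in> A" for v
    proof -
      have "size (filter_mset (\<lambda>z. snd z = v) (mset zs)) = Suc (Suc 0)"
        using v fin by (simp add: size_filter_snd_eq ms)
      then obtain z N where zN: "filter_mset (\<lambda>z. snd z = v) (mset zs) = add_mset z N"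
        using size_eq_Suc_imp_eq_union by blast
      then have "size N = Suc 0"
        using \<open>size _ = Suc (Suc 0)\<close> by simp
      then obtain w where "N = {#w#}"
        using size_1_singleton_mset[of N] by auto
      with zN have zw: "filter_mset (\<lambda>z. snd z = v) (mset zs) = {#z, w#}" by simp
      then have "z \<in># filter_mset (\<lambda>z. snd z = v) (mset zs)" "w \<in># filter_mset (\<lambda>z. snd z = v) (mset zs)"
        by simp_all
      then obtain x y where "z = (x, v)" "w = (y, v)" by (cases z, cases w) auto
      with zw have "filter_mset (\<lambda>z. snd z = v) (mset zs) = {#(x, v), (y, v)#}"
        "filter_mset (\<lambda>z. snd z = v) (mset zs) = {#(y, v), (x, v)#}" by simp_all
      then show ?thesis using linear[of x y] by blast
    qed
    then have "\<forall>v\<in>A. \<exists>x. \<exists>y. x \<le> y \<and> filter_mset (\<lambda>z. snd z = v) (mset zs) = {#(x, v), (y, v)#}"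
      by blast
    from bchoice[OF this] obtain f0 where
      "\<forall>v\<in>A. \<exists>y. f0 v \<le> y \<and> filter_mset (\<lambda>z. snd z = v) (mset zs) = {#(f0 v, v), (y, v)#}" ..
    from bchoice[OF this] obtain g0 where fg0:
      "\<forall>v\<in>A. f0 v \<le> g0 v \<and> filter_mset (\<lambda>z. snd z = v) (mset zs) = {#(f0 v, v), (g0 v, v)#}" ..
    \<comment> \<open>The restriction supplies the fixed default value outside \<open>A\<close> that
      \<open>level_pairs\<close> demands.\<close>
    define f where "f = restrict f0 A"
    define g where "g = restrict g0 A"
    have le: "f v \<le> g v" if "v \<in> A" for v using fg0 that by (simp add: f_def g_def)
    have flt: "filter_mset (\<lambda>z. snd z = v) (mset zs) = {#(f v, v), (g v, v)#}" if "v \<in> A" for v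
      using fg0 that by (simp add: f_def g_def)
    have mz: "mset zs = copies A f g"
    proof (rule multiset_eqI)
      fix z :: "nat \<times> 'a"
      obtain h v where z: "z = (h, v)" by (cases z)
      show "count (mset zs) z = count (copies A f g) z"
      proof (cases "v \<in> A")
        case True
        have "count (mset zs) z = count (filter_mset (\<lambda>z. snd z = v) (mset zs)) z"
          by (simp add: z)
        then show ?thesis using flt[OF True] True by (simp add: z count_copies[OF fin])
      next
        case False
        have "set_mset (image_mset snd (mset zs)) = A" using ms fin by simp
        then have "z \<notin># mset zs" using False z by force
        then show ?thesis using False z by (simp add: count_copies[OF fin] not_in_iff)
      qed
    qed
    have "f v < m \<and> g v < m" if "v \<in> A" for v
    proof -
      have "{(f v, v), (g v, v)} \<subseteq> set zs"
        using arg_cong[OF flt[OF that], of set_mset] by auto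
      then show ?thesis using bd by auto
    qed
    then have "f \<in> A \<rightarrow>\<^sub>E {..<m}" "g \<in> A \<rightarrow>\<^sub>E {..<m}" by (auto simp: f_def g_def)
    then have "(f, g) \<in> level_pairs A m"
      using nn nonnesting_copies_iff[OF fin le sz mz] le by (auto simp: level_pairs_def)
    moreover have "zs = ?F (f, g)"
      using sz mz by (metis case_prod_conv sorted_list_of_multiset_mset sorted_sort_id)
    ultimately show "zs \<in> ?F ` level_pairs A m" by blast
  qed
qed

text \<open>Raising every second level by one keeps the lexicographic order of the second copies,
  hence the nonnesting condition, and turns \<open>f v \<le> g v\<close> into
  \<open>f v < g v\<close>. Only the bound on \<open>g\<close> has to grow: in the target,
  \<open>f v < g v \<le> m\<close> still gives \<open>f v < m\<close>.\<close>

lemma bij_betw_shift_level_pairs: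
  "bij_betw (\<lambda>(f, g). (f, \<lambda>v\<in>A. Suc (g v))) (level_pairs A m)
     {(f, g) \<in> level_pairs A (Suc m). \<forall>v\<in>A. f v \<noteq> g v}"
proof (rule bij_betw_byWitness[where f' = "\<lambda>(f, g). (f, \<lambda>v\<in>A. g v - 1)"])
  show "\<forall>x\<in>level_pairs A m.
      (\<lambda>(f, g). (f, \<lambda>v\<in>A. g v - 1)) ((\<lambda>(f, g). (f, \<lambda>v\<in>A. Suc (g v))) x) = x"
  proof -
    have "(\<lambda>v\<in>A. (\<lambda>v\<in>A. Suc (g v)) v - 1) = g" if "(f, g) \<in> level_pairs A m" for f g
      using that by (auto simp: level_pairs_def PiE_iff extensional_def)
    then show ?thesis by auto
  qed
  show "\<forall>x\<in>{(f, g) \<in> level_pairs A (Suc m). \<forall>v\<in>A. f v \<noteq> g v}.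
      (\<lambda>(f, g). (f, \<lambda>v\<in>A. Suc (g v))) ((\<lambda>(f, g). (f, \<lambda>v\<in>A. g v - 1)) x) = x"
  proof -
    have "(\<lambda>v\<in>A. Suc ((\<lambda>v\<in>A. g v - 1) v)) = g"
      if fg: "(f, g) \<in> level_pairs A (Suc m)" "\<forall>v\<in>A. f v \<noteq> g v" for f g
    proof -
      have "g \<in> extensional A" using fg(1) by (simp add: level_pairs_def PiE_iff)
      \<comment> \<open>Positivity keeps the truncated \<open>g v - 1\<close> from losing
        information.\<close>
      moreover have "g v > 0" if "v \<in> A" for v
      proof -
        have "f v \<le> g v" using fg(1) that by (simp add: level_pairs_def)
        then show ?thesis using fg(2) that by (cases "g v") auto
      qed
      ultimately show ?thesis by (auto simp: extensional_def)
    qed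
    then show ?thesis by auto
  qed
  show "(\<lambda>(f, g). (f, \<lambda>v\<in>A. Suc (g v))) ` level_pairs A m
      \<subseteq> {(f, g) \<in> level_pairs A (Suc m). \<forall>v\<in>A. f v \<noteq> g v}"
  proof (rule image_subsetI, clarify)
    fix f g assume fg: "(f, g) \<in> level_pairs A m"
    have "(Suc (g b), b) < (Suc (g a), a) \<longleftrightarrow> (g b, b) < (g a, a)" for a b
      by simp
    moreover have "f v < Suc m" "f v < Suc (g v)" "Suc (g v) < Suc m" if "v \<in> A" for v
      using fg that by (auto simp: level_pairs_def PiE_iff less_Suc_eq_le less_imp_le)
    ultimately show "(f, \<lambda>v\<in>A. Suc (g v)) \<in> level_pairs A (Suc m) \<and>
        (\<forall>v\<in>A. f v \<noteq> (\<lambda>v\<in>A. Suc (g v)) v)"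
      using fg unfolding level_pairs_def PiE_iff
      by (simp del: less_prod_simp add: less_imp_le less_imp_neq)
  qed
  show "(\<lambda>(f, g). (f, \<lambda>v\<in>A. g v - 1)) ` {(f, g) \<in> level_pairs A (Suc m). \<forall>v\<in>A. f v \<noteq> g v}
      \<subseteq> level_pairs A m"
  proof (clarify)
    fix f g assume fg: "(f, g) \<in> level_pairs A (Suc m)" "\<forall>v\<in>A. f v \<noteq> g v"
    then have lt: "f v < g v \<and> g v < Suc m" if "v \<in> A" for v
      using that by (simp add: level_pairs_def PiE_iff le_less)
    \<comment> \<open>Lowering preserves the order because both second levels are positive.\<close>
    have "(g b - 1, b) < (g a - 1, a) \<longleftrightarrow> (g b, b) < (g a, a)" if "a \<in> A" "b \<in> A" for a b
      using lt[OF that(1)] lt[OF that(2)] by auto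
    moreover have "f v < m" "f v \<le> g v - 1" "g v - 1 < m" if "v \<in> A" for v
      using lt[OF that] by auto
    ultimately show "(f, \<lambda>v\<in>A. g v - 1) \<in> level_pairs A m"
      using fg(1) unfolding level_pairs_def PiE_iff
      by (simp del: less_prod_simp)
  qed
qed

text \<open>A word repeats a pair exactly when \<open>f v = g v\<close> for some value
  \<open>v\<close>. The words without repetition therefore correspond to the image of the
  shift.\<close>

lemma card_levelled_words_distinct:
  fixes A :: "'a::linorder set"
  assumes fin: "finite A"
  shows "card {zs \<in> levelled_words A (Suc m). distinct zs} = card (levelled_words A m)"
proof -
  let ?F = "\<lambda>(f, g). sorted_list_of_multiset (copies A f g)"
  have iff: "distinct (?F x) \<longleftrightarrow> x \<in> {(f, g). \<forall>v\<in>A. f v \<noteq> g v}" for x :: "('a \<Rightarrow> nat) \<times> ('a \<Rightarrow> nat)"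
  proof -
    obtain f g where x: "x = (f, g)" by (cases x)
    have "distinct (?F x) \<longleftrightarrow> (\<forall>z. count (copies A f g) z \<le> 1)"
      by (simp add: x distinct_iff_count_le_1)
    also have "\<dots> \<longleftrightarrow> (\<forall>v\<in>A. f v \<noteq> g v)"
    proof
      assume le1: "\<forall>z. count (copies A f g) z \<le> 1"
      show "\<forall>v\<in>A. f v \<noteq> g v"
      proof
        fix v assume "v \<in> A"
        then show "f v \<noteq> g v"
          using le1[rule_format, of "(f v, v)"] by (auto simp: count_copies[OF fin])
      qed
    next
      assume ne: "\<forall>v\<in>A. f v \<noteq> g v"
      show "\<forall>z. count (copies A f g) z \<le> 1"
      proof
        fix z :: "nat \<times> 'a"
        show "count (copies A f g) z \<le> 1"
          using ne by (cases z) (auto simp: count_copies[OF fin])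
      qed
    qed
    finally show ?thesis using x by simp
  qed
  have "bij_betw ?F {x \<in> level_pairs A (Suc m). x \<in> {(f, g). \<forall>v\<in>A. f v \<noteq> g v}}
     {zs \<in> levelled_words A (Suc m). distinct zs}"
    using bij_betw_level_pairs[OF fin, of "Suc m"] iff
    unfolding bij_betw_def inj_on_def by blast
  moreover have "{x \<in> level_pairs A (Suc m). x \<in> {(f, g). \<forall>v\<in>A. f v \<noteq> g v}}
     = {(f, g) \<in> level_pairs A (Suc m). \<forall>v\<in>A. f v \<noteq> g v}" by auto
  ultimately have "card {zs \<in> levelled_words A (Suc m). distinct zs}
     = card {(f, g) \<in> level_pairs A (Suc m). \<forall>v\<in>A. f v \<noteq> g v}"
    by (metis (no_types, lifting) bij_betw_same_card)
  then show ?thesis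
    using bij_betw_same_card[OF bij_betw_shift_level_pairs[of A m]]
      bij_betw_same_card[OF bij_betw_level_pairs[OF fin, of m]] by simp
qed

section \<open>Counting levelled nonnesting permutations\<close>

lemma nonnesting_perms_iff:
  "p \<in> nonnesting_perms n \<longleftrightarrow> mset p = mset_set {1..n} + mset_set {1..n} \<and> nonnesting p"
  by (simp add: nonnesting_perms_def permutations_of_multiset_def)

lemma finite_nonnesting_perms: "finite (nonnesting_perms n)"
  by (simp add: nonnesting_perms_def)

lemma length_nonnesting_perms: "p \<in> nonnesting_perms n \<Longrightarrow> length p = 2 * n"
  by (auto simp: nonnesting_perms_iff simp flip: size_mset)

text \<open>Unzipping a levelled word separates the permutation from its levels, and the count
  splits over the permutations. The predicate \<open>Q\<close> covers both the unrestricted and the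
  distinct words.\<close>

lemma card_levelled_words:
  "card {zs \<in> levelled_words {1..n} m. Q zs}
     = (\<Sum>p\<in>nonnesting_perms n.
          card {h. length h = length p \<and> set h \<subseteq> {..<m} \<and> sorted (zip h p) \<and> Q (zip h p)})"
    (is "card ?W = (\<Sum>p\<in>_. card (?H p))")
proof -
  have "bij_betw (\<lambda>zs. (map snd zs, map fst zs)) ?W (SIGMA p:nonnesting_perms n. ?H p)"
  proof (rule bij_betw_byWitness[where f' = "\<lambda>(p, h). zip h p"])
    show "(\<lambda>zs. (map snd zs, map fst zs)) ` ?W \<subseteq> (SIGMA p:nonnesting_perms n. ?H p)"
      by (force simp: levelled_words_def nonnesting_perms_iff zip_map_fst_snd)
    have "zip h p \<in> ?W" if "p \<in> nonnesting_perms n" "h \<in> ?H p" for p h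
    proof -
      have len: "length h = length p" using that(2) by simp
      have "fst ` set (zip h p) \<subseteq> set h" by (auto dest: set_zip_leftD)
      then have "fst ` set (zip h p) \<subseteq> {..<m}" using that(2) by auto
      then show ?thesis
        using that map_snd_zip[OF len] unfolding levelled_words_def nonnesting_perms_iff
        by (simp del: mset_map)
    qed
    then show "(\<lambda>(p, h). zip h p) ` (SIGMA p:nonnesting_perms n. ?H p) \<subseteq> ?W" by auto
  qed (auto simp: zip_map_fst_snd)
  then have "card ?W = card (SIGMA p:nonnesting_perms n. ?H p)"
    by (rule bij_betw_same_card)
  also have "\<dots> = (\<Sum>p\<in>nonnesting_perms n. card (?H p))"
  proof (rule card_SigmaI)
    show "\<forall>p\<in>nonnesting_perms n. finite (?H p)"
    proof
      fix p
      show "finite (?H p)"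
        by (rule finite_subset[OF _ finite_lists_length_eq[of "{..<m}" "length p"]]) auto
    qed
  qed (rule finite_nonnesting_perms)
  finally show ?thesis .
qed

text \<open>The sums for \<open>des\<close> count all levelled words, those for \<open>wdes\<close>
  only the distinct ones. The shift by one in the bound becomes the \<open>Suc\<close> on
  \<open>des\<close>, and the sums determine the distributions.\<close>

lemma wdes_equidistributed_Suc_des:
  assumes "n \<ge> 1"
  shows "card {p \<in> nonnesting_perms n. wdes p = k} = card {p \<in> nonnesting_perms n. Suc (des p) = k}"
proof -
  define g where "g j = card {h :: nat list. length h = 2 * n \<and> set h \<subseteq> {..<j} \<and> sorted h}" for j
  have ne: "p \<noteq> []" if "p \<in> nonnesting_perms n" for p
    using length_nonnesting_perms[OF that] assms by auto
  have g0: "g 0 = 0" using assms by (auto simp: g_def)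
  \<comment> \<open>With a single level available, the constant sequence witnesses
    \<open>g 1 > 0\<close>.\<close>
  have "replicate (2 * n) 0 \<in> {h :: nat list. length h = 2 * n \<and> set h \<subseteq> {..<1} \<and> sorted h}"
    by auto
  moreover have "finite {h :: nat list. length h = 2 * n \<and> set h \<subseteq> {..<1} \<and> sorted h}"
    by (rule finite_subset[OF _ finite_lists_length_eq[of "{..<1}" "2 * n"]]) auto
  ultimately have g1: "g 1 > 0" unfolding g_def card_gt_0_iff by blast
  have weak: "(\<Sum>p\<in>nonnesting_perms n. g (m - des p)) = card (levelled_words {1..n} m)" for m
    using card_levelled_words[of n m "\<lambda>_. True"] card_sorted_zip[OF ne]
    by (simp add: g_def length_nonnesting_perms)
  have strict: "(\<Sum>p\<in>nonnesting_perms n. g (m - wdes p))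
      = card {zs \<in> levelled_words {1..n} m. distinct zs}" for m
    unfolding card_levelled_words
    by (rule sum.cong[OF refl])
      (use card_strict_sorted_zip[OF ne] in \<open>simp add: g_def length_nonnesting_perms\<close>)
  have "(\<Sum>p\<in>nonnesting_perms n. g (m - wdes p)) = (\<Sum>p\<in>nonnesting_perms n. g (m - Suc (des p)))" for m
  \<comment> \<open>For \<open>m = 0\<close> all terms are \<open>g 0 = 0\<close>; otherwise
    \<open>m - Suc (des p)\<close> equals \<open>m' - des p\<close>, and the shift from
    \<open>m'\<close> to \<open>Suc m'\<close> applies.\<close>
  proof (cases m)
    case 0
    then show ?thesis by (simp add: g0)
  next
    case (Suc m')
    then show ?thesis
      using weak[of m'] strict[of m] card_levelled_words_distinct[of "{1..n}" m'] by simp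
  qed
  from card_level_sets_eq_from_sums[of _ g, OF finite_nonnesting_perms g0 g1 this]
  show ?thesis .
qed

section \<open>Reversal and the symmetry\<close>

lemma des_rev:
  assumes "p \<noteq> []"
  shows "Suc (des (rev p)) + wdes p = length p"
proof -
  let ?L = "length p"
  let ?W = "{i. Suc i < ?L \<and> p ! i \<ge> p ! Suc i}" and ?A = "{i. Suc i < ?L \<and> p ! i < p ! Suc i}"
  \<comment> \<open>Positions \<open>i\<close> and \<open>Suc i\<close> of the reversed word are
    positions \<open>?L - 1 - i\<close> and \<open>?L - 2 - i\<close> of \<open>p\<close>; the
    adjacent pair thus starts at the latter.\<close>
  have "bij_betw (\<lambda>i. ?L - 2 - i) {i. Suc i < ?L \<and> rev p ! i > rev p ! Suc i} ?A"
    by (rule bij_betw_byWitness[where f' = "\<lambda>i. ?L - 2 - i"])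
      (auto simp: rev_nth Suc_diff_Suc numeral_2_eq_2 Suc_diff_le)
  then have "des (rev p) = card ?A"
    unfolding des_def by (simp add: bij_betw_same_card)
  moreover have "card ?A + card ?W = card (?A \<union> ?W)"
    by (rule card_Un_disjoint[symmetric]) (auto intro: finite_subset[of _ "{..<?L}"])
  \<comment> \<open>Each of the \<open>?L - 1\<close> adjacent pairs is either a strict ascent or a
    weak descent; the outer \<open>Suc\<close> in the statement makes up for the missing
    one.\<close>
  moreover have "?A \<union> ?W = {..<?L - 1}" by auto
  ultimately show ?thesis using assms by (simp add: wdes_def)
qed

lemma nonnesting_rev:
  assumes "nonnesting p"
  shows "nonnesting (rev p)"
  unfolding nonnesting_def
proof (rule notI, elim exE conjE)
  fix i j l m
  assume *: "i < j" "j < l" "l < m" "m < length (rev p)"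
    "rev p ! i = rev p ! m" "rev p ! j = rev p ! l"
  let ?r = "\<lambda>k. length p - Suc k"
  have "?r m < ?r l" "?r l < ?r j" "?r j < ?r i" "?r i < length p"
    using * by auto
  moreover have "p ! ?r m = p ! ?r i" "p ! ?r l = p ! ?r j"
    using * by (simp_all add: rev_nth)
  ultimately show False using assms unfolding nonnesting_def by blast
qed

theorem corollary2p3:
  fixes n :: nat and r :: int
  assumes "n \<ge> 1"
  shows "card {p \<in> nonnesting_perms n. int (wdes p) = r}
       = card {p \<in> nonnesting_perms n. int (wdes p) = 2 * int n - r}"
proof -
  have rev_in: "rev p \<in> nonnesting_perms n" if "p \<in> nonnesting_perms n" for p
    using that nonnesting_rev[of p] by (simp add: nonnesting_perms_iff)
  have sum: "int (Suc (des (rev p))) + int (wdes p) = 2 * int n" if "p \<in> nonnesting_perms n" for p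
  proof -
    have "p \<noteq> []" using length_nonnesting_perms[OF that] assms by auto
    then show ?thesis using des_rev[of p] length_nonnesting_perms[OF that] by simp
  qed
  have "card {p \<in> nonnesting_perms n. int (wdes p) = r}
      = card {p \<in> nonnesting_perms n. int (Suc (des p)) = r}"
  \<comment> \<open>Both statistics are natural numbers, so both sets are empty for negative
    \<open>r\<close>.\<close>
  proof (cases "r < 0")
    case True
    then have "int (wdes p) \<noteq> r" "int (Suc (des p)) \<noteq> r" for p by auto
    then show ?thesis by (simp del: of_nat_Suc)
  next
    case False
    then have "r = int (nat r)" by simp
    then obtain k where "r = int k" ..
    then show ?thesis
      using wdes_equidistributed_Suc_des[OF assms, of k] by (simp only: of_nat_eq_iff)
  qed
  also have "\<dots> = card {p \<in> nonnesting_perms n. int (wdes p) = 2 * int n - r}"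
  proof (rule bij_betw_same_card)
    \<comment> \<open>Reversal is an involution on the nonnesting permutations, and
      \<open>sum\<close> converts one statistic into the complement of the other.\<close>
    show "bij_betw rev {p \<in> nonnesting_perms n. int (Suc (des p)) = r}
        {p \<in> nonnesting_perms n. int (wdes p) = 2 * int n - r}"
    proof (rule bij_betw_byWitness[where f' = rev])
      show "rev ` {p \<in> nonnesting_perms n. int (Suc (des p)) = r}
          \<subseteq> {p \<in> nonnesting_perms n. int (wdes p) = 2 * int n - r}"
        using rev_in sum[OF rev_in] by fastforce
      show "rev ` {p \<in> nonnesting_perms n. int (wdes p) = 2 * int n - r}
          \<subseteq> {p \<in> nonnesting_perms n. int (Suc (des p)) = r}"
        using rev_in sum by fastforce
    qed auto
  qed
  finally show ?thesis .
qed

end
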